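(* Let $\alpha$ be an io-disjoint FLIF expression over a schema $\mathcal S$. There exists an $I(\alpha)$-executable FO formula $\varphi_\alpha$ over $\mathcal S$ with $\mathrm{FV}(\varphi_\alpha)=\mathrm{vars}(\alpha)$, whose length is linear in the length of $\alpha$, such that for every instance $D$ and every valuation $\nu_{\rm in}$ on $I(\alpha)$, \[\mathrm{Eval}_\alpha(D,\nu_{\rm in})=\mathrm{Eval}_{\varphi_\alpha,I(\alpha)}(D,\nu_{\rm in}).\] Here $\mathrm{Eval}_\alpha(D,\nu_{\rm in})=\{\nu_{\rm out}|_{\mathrm{vars}(\alpha)}\mid \exists\nu_{\rm in}'\supseteq\nu_{\rm in}\text{ with }(\nu_{\rm in}',\nu_{\rm out})\in[\![\alpha]\!]_D\}$, and $\mathrm{Eval}_{\varphi,V}(D,\nu_{\rm in})$ is the set of all valuations $\nu$ on $V\cup\mathrm{FV}(\varphi)$ with $\nu_{\rm in}\subseteq\nu$ and $D,\nu\models\varphi$.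
   Context: Fix a countably infinite set $\mathbf{dom}$ of constants and the set $\mathcal U$ of all variables. A schema $\mathcal S$ is a finite set of relation names $R$ with arity $\mathrm{ar}(R)$ and input arity $\mathrm{iar}(R)\le\mathrm{ar}(R)$; $\mathrm{oar}(R)=\mathrm{ar}(R)-\mathrm{iar}(R)$. An instance $D$ assigns each $R$ a relation $D(R)\subseteq\mathbf{dom}^{\mathrm{ar}(R)}$. Valuations on a set $X$ are maps $X\to\mathbf{dom}$; $\nu(c)=c$ for constants; $\nu[x:=c]$ is $\nu$ changed at $x$. FLIF expressions: atomic $R(\bar x;\bar y)$ ($\bar x$ of length $\mathrm{iar}(R)$, $\bar y$ of length $\mathrm{oar}(R)$), $(x=y)$, $(x=c)$, $(x:=y)$, $(x:=c)$; closed under $;$, $\cup$, $-$. $\mathrm{vars}(\alpha)$ is the set of variables occurring in $\alpha$. Semantics $[\![\alpha]\!]_D$ (pairs of valuations on $\mathcal U$): $R(\bar x;\bar y)$: $(\nu_1,\nu_2)$ with $\nu_1(\bar x)\cdot\nu_2(\bar y)\in D(R)$ and $\nu_1,\nu_2$ agreeing outside the variables of $\bar y$; $(x=y)$: $(\nu,\nu)$ with $\nu(x)=\nu(y)$; $(x=c)$: $(\nu,\nu)$ with $\nu(x)=c$; $(x:=y)$: $(\nu,\nu[x:=\nu(y)])$; $(x:=c)$: $(\nu,\nu[x:=c])$; $;$ relational composition, $\cup,-$ union and difference. Input/output variables: $I(R(\bar x;\bar y))=X$, $O=Y$ (variables of $\bar x$, $\bar y$); $I(x=y)=\{x,y\}$,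 $O=\emptyset$; $I(x:=y)=\{y\}$, $O=\{x\}$; $I(x=c)=\{x\}$, $O=\emptyset$; $I(x:=c)=\emptyset$, $O=\{x\}$; $I(\alpha_1;\alpha_2)=I(\alpha_1)\cup(I(\alpha_2)\setminus O(\alpha_1))$, $O=O(\alpha_1)\cup O(\alpha_2)$; $I(\alpha_1\cup\alpha_2)=I(\alpha_1)\cup I(\alpha_2)\cup(O(\alpha_1)\triangle O(\alpha_2))$, $O=O(\alpha_1)\cup O(\alpha_2)$; $I(\alpha_1-\alpha_2)=I(\alpha_1)\cup I(\alpha_2)\cup(O(\alpha_1)\triangle O(\alpha_2))$, $O=O(\alpha_1)$. io-disjoint: $I(\beta)\cap O(\beta)=\emptyset$ for every subexpression $\beta$ (including itself). FO formulas over $\mathcal S$: relation atoms $R(\bar x;\bar y)$, equalities $x=y$, $x=c$, and $\neg,\wedge,\vee,\exists$, natural semantics over $\mathbf{dom}$. $V$-executability: $x=y$ if $x\in V$ or $y\in V$; $x=c$ always; $R(\bar x;\bar y)$ if the variables of $\bar x$ lie in $V$; $\neg\varphi$ if $\varphi$ is and $\mathrm{FV}(\varphi)\subseteq V$; $\varphi\wedge\psi$ if $\varphi$ is $V$-executable and $\psi$ is $(V\cup\mathrm{FV}(\varphi))$-executable; $\varphi\vee\psi$ if both are $V$-executable and $\mathrm{FV}(\varphi)\triangle\mathrm{FV}(\psi)\subseteq V$; $\exists x\,\varphi$ if $\varphi$ is $(V\setminus\{x\})$-executable. *)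

theory Defs
  imports Main "HOL-Library.Countable" "HOL-Library.Infinite_Typeclass"
begin

(* Type variables: 'r relation names, 'v variables (the universe U is UNIV :: 'v set),
   'd constants (the domain dom is UNIV :: 'd set). *)

record 'r schema =
  rels :: "'r set"
  ar :: "'r \<Rightarrow> nat"
  iar :: "'r \<Rightarrow> nat"

definition is_schema :: "'r schema \<Rightarrow> bool" where
  "is_schema S \<longleftrightarrow> finite (rels S) \<and> (\<forall>R\<in>rels S. iar S R \<le> ar S R)"

definition oar :: "'r schema \<Rightarrow> 'r \<Rightarrow> nat" where
  "oar S R = ar S R - iar S R"

(* Values of an instance outside the schema are unconstrained; they are never consulted
   by an expression or formula over the schema. *)
type_synonym ('r, 'd) inst = "'r \<Rightarrow> 'd list set"

definition is_instance :: "'r schema \<Rightarrow> ('r, 'd) inst \<Rightarrow> bool" where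
  "is_instance S D \<longleftrightarrow> (\<forall>R\<in>rels S. \<forall>t\<in>D R. length t = ar S R)"

(* A valuation on all variables is a total function 'v \<Rightarrow> 'd; a valuation on a set X is a
   partial map \<nu> :: 'v \<rightharpoonup> 'd with dom \<nu> = X, and extension of valuations is map_le. *)

datatype ('r, 'v, 'd) flif =
    FRel 'r "'v list" "'v list"
  | FTestVar 'v 'v
  | FTestConst 'v 'd
  | FAssignVar 'v 'v
  | FAssignConst 'v 'd
  | FComp "('r, 'v, 'd) flif" "('r, 'v, 'd) flif"
  | FUnion "('r, 'v, 'd) flif" "('r, 'v, 'd) flif"
  | FDiff "('r, 'v, 'd) flif" "('r, 'v, 'd) flif"

primrec flif_over :: "'r schema \<Rightarrow> ('r, 'v, 'd) flif \<Rightarrow> bool" where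
  "flif_over S (FRel R xs ys) \<longleftrightarrow> R \<in> rels S \<and> length xs = iar S R \<and> length ys = oar S R"
| "flif_over S (FTestVar x y) \<longleftrightarrow> True"
| "flif_over S (FTestConst x c) \<longleftrightarrow> True"
| "flif_over S (FAssignVar x y) \<longleftrightarrow> True"
| "flif_over S (FAssignConst x c) \<longleftrightarrow> True"
| "flif_over S (FComp \<alpha> \<beta>) \<longleftrightarrow> flif_over S \<alpha> \<and> flif_over S \<beta>"
| "flif_over S (FUnion \<alpha> \<beta>) \<longleftrightarrow> flif_over S \<alpha> \<and> flif_over S \<beta>"
| "flif_over S (FDiff \<alpha> \<beta>) \<longleftrightarrow> flif_over S \<alpha> \<and> flif_over S \<beta>"

primrec flif_vars :: "('r, 'v, 'd) flif \<Rightarrow> 'v set" where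
  "flif_vars (FRel R xs ys) = set xs \<union> set ys"
| "flif_vars (FTestVar x y) = {x, y}"
| "flif_vars (FTestConst x c) = {x}"
| "flif_vars (FAssignVar x y) = {x, y}"
| "flif_vars (FAssignConst x c) = {x}"
| "flif_vars (FComp \<alpha> \<beta>) = flif_vars \<alpha> \<union> flif_vars \<beta>"
| "flif_vars (FUnion \<alpha> \<beta>) = flif_vars \<alpha> \<union> flif_vars \<beta>"
| "flif_vars (FDiff \<alpha> \<beta>) = flif_vars \<alpha> \<union> flif_vars \<beta>"

primrec flif_sem :: "('r, 'd) inst \<Rightarrow> ('r, 'v, 'd) flif \<Rightarrow> (('v \<Rightarrow> 'd) \<times> ('v \<Rightarrow> 'd)) set" where
  "flif_sem D (FRel R xs ys) =
     {(\<nu>1, \<nu>2). map \<nu>1 xs @ map \<nu>2 ys \<in> D R \<and> (\<forall>z. z \<notin> set ys \<longrightarrow> \<nu>1 z = \<nu>2 z)}"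
| "flif_sem D (FTestVar x y) = {(\<nu>, \<nu>) | \<nu>. \<nu> x = \<nu> y}"
| "flif_sem D (FTestConst x c) = {(\<nu>, \<nu>) | \<nu>. \<nu> x = c}"
| "flif_sem D (FAssignVar x y) = {(\<nu>, \<nu>(x := \<nu> y)) | \<nu>. True}"
| "flif_sem D (FAssignConst x c) = {(\<nu>, \<nu>(x := c)) | \<nu>. True}"
| "flif_sem D (FComp \<alpha> \<beta>) = flif_sem D \<alpha> O flif_sem D \<beta>"
| "flif_sem D (FUnion \<alpha> \<beta>) = flif_sem D \<alpha> \<union> flif_sem D \<beta>"
| "flif_sem D (FDiff \<alpha> \<beta>) = flif_sem D \<alpha> - flif_sem D \<beta>"

primrec flif_out :: "('r, 'v, 'd) flif \<Rightarrow> 'v set" where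
  "flif_out (FRel R xs ys) = set ys"
| "flif_out (FTestVar x y) = {}"
| "flif_out (FTestConst x c) = {}"
| "flif_out (FAssignVar x y) = {x}"
| "flif_out (FAssignConst x c) = {x}"
| "flif_out (FComp \<alpha> \<beta>) = flif_out \<alpha> \<union> flif_out \<beta>"
| "flif_out (FUnion \<alpha> \<beta>) = flif_out \<alpha> \<union> flif_out \<beta>"
| "flif_out (FDiff \<alpha> \<beta>) = flif_out \<alpha>"

primrec flif_in :: "('r, 'v, 'd) flif \<Rightarrow> 'v set" where
  "flif_in (FRel R xs ys) = set xs"
| "flif_in (FTestVar x y) = {x, y}"
| "flif_in (FTestConst x c) = {x}"
| "flif_in (FAssignVar x y) = {y}"
| "flif_in (FAssignConst x c) = {}"
| "flif_in (FComp \<alpha> \<beta>) = flif_in \<alpha> \<union> (flif_in \<beta> - flif_out \<alpha>)"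
| "flif_in (FUnion \<alpha> \<beta>) = flif_in \<alpha> \<union> flif_in \<beta> \<union> sym_diff (flif_out \<alpha>) (flif_out \<beta>)"
| "flif_in (FDiff \<alpha> \<beta>) = flif_in \<alpha> \<union> flif_in \<beta> \<union> sym_diff (flif_out \<alpha>) (flif_out \<beta>)"

primrec subexprs :: "('r, 'v, 'd) flif \<Rightarrow> ('r, 'v, 'd) flif set" where
  "subexprs (FRel R xs ys) = {FRel R xs ys}"
| "subexprs (FTestVar x y) = {FTestVar x y}"
| "subexprs (FTestConst x c) = {FTestConst x c}"
| "subexprs (FAssignVar x y) = {FAssignVar x y}"
| "subexprs (FAssignConst x c) = {FAssignConst x c}"
| "subexprs (FComp \<alpha> \<beta>) = {FComp \<alpha> \<beta>} \<union> subexprs \<alpha> \<union> subexprs \<beta>"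
| "subexprs (FUnion \<alpha> \<beta>) = {FUnion \<alpha> \<beta>} \<union> subexprs \<alpha> \<union> subexprs \<beta>"
| "subexprs (FDiff \<alpha> \<beta>) = {FDiff \<alpha> \<beta>} \<union> subexprs \<alpha> \<union> subexprs \<beta>"

definition io_disjoint :: "('r, 'v, 'd) flif \<Rightarrow> bool" where
  "io_disjoint \<alpha> \<longleftrightarrow> (\<forall>\<beta>\<in>subexprs \<alpha>. flif_in \<beta> \<inter> flif_out \<beta> = {})"

(* Lengths (here and for formulas) count the occurrences of relation names, variables,
   constants and operator symbols; brackets and separators are not counted. *)
primrec flif_length :: "('r, 'v, 'd) flif \<Rightarrow> nat" where
  "flif_length (FRel R xs ys) = 1 + length xs + length ys"
| "flif_length (FTestVar x y) = 3"
| "flif_length (FTestConst x c) = 3"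
| "flif_length (FAssignVar x y) = 3"
| "flif_length (FAssignConst x c) = 3"
| "flif_length (FComp \<alpha> \<beta>) = 1 + flif_length \<alpha> + flif_length \<beta>"
| "flif_length (FUnion \<alpha> \<beta>) = 1 + flif_length \<alpha> + flif_length \<beta>"
| "flif_length (FDiff \<alpha> \<beta>) = 1 + flif_length \<alpha> + flif_length \<beta>"

definition flif_eval ::
  "('r, 'v, 'd) flif \<Rightarrow> ('r, 'd) inst \<Rightarrow> ('v \<rightharpoonup> 'd) \<Rightarrow> ('v \<rightharpoonup> 'd) set" where
  "flif_eval \<alpha> D \<nu>in =
     {(Some \<circ> \<nu>out) |` flif_vars \<alpha> | \<nu>out.
        \<exists>\<nu>in'. \<nu>in \<subseteq>\<^sub>m (Some \<circ> \<nu>in') \<and> (\<nu>in', \<nu>out) \<in> flif_sem D \<alpha>}"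

datatype ('r, 'v, 'd) fo =
    Rel 'r "'v list" "'v list"
  | EqVar 'v 'v
  | EqConst 'v 'd
  | Neg "('r, 'v, 'd) fo"
  | And "('r, 'v, 'd) fo" "('r, 'v, 'd) fo"
  | Or "('r, 'v, 'd) fo" "('r, 'v, 'd) fo"
  | Ex 'v "('r, 'v, 'd) fo"

primrec fo_over :: "'r schema \<Rightarrow> ('r, 'v, 'd) fo \<Rightarrow> bool" where
  "fo_over S (Rel R xs ys) \<longleftrightarrow> R \<in> rels S \<and> length xs = iar S R \<and> length ys = oar S R"
| "fo_over S (EqVar x y) \<longleftrightarrow> True"
| "fo_over S (EqConst x c) \<longleftrightarrow> True"
| "fo_over S (Neg \<phi>) \<longleftrightarrow> fo_over S \<phi>"
| "fo_over S (And \<phi> \<psi>) \<longleftrightarrow> fo_over S \<phi> \<and> fo_over S \<psi>"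
| "fo_over S (Or \<phi> \<psi>) \<longleftrightarrow> fo_over S \<phi> \<and> fo_over S \<psi>"
| "fo_over S (Ex x \<phi>) \<longleftrightarrow> fo_over S \<phi>"

primrec FV :: "('r, 'v, 'd) fo \<Rightarrow> 'v set" where
  "FV (Rel R xs ys) = set xs \<union> set ys"
| "FV (EqVar x y) = {x, y}"
| "FV (EqConst x c) = {x}"
| "FV (Neg \<phi>) = FV \<phi>"
| "FV (And \<phi> \<psi>) = FV \<phi> \<union> FV \<psi>"
| "FV (Or \<phi> \<psi>) = FV \<phi> \<union> FV \<psi>"
| "FV (Ex x \<phi>) = FV \<phi> - {x}"

primrec fo_sat :: "('r, 'd) inst \<Rightarrow> ('v \<Rightarrow> 'd) \<Rightarrow> ('r, 'v, 'd) fo \<Rightarrow> bool" where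
  "fo_sat D \<nu> (Rel R xs ys) \<longleftrightarrow> map \<nu> xs @ map \<nu> ys \<in> D R"
| "fo_sat D \<nu> (EqVar x y) \<longleftrightarrow> \<nu> x = \<nu> y"
| "fo_sat D \<nu> (EqConst x c) \<longleftrightarrow> \<nu> x = c"
| "fo_sat D \<nu> (Neg \<phi>) \<longleftrightarrow> \<not> fo_sat D \<nu> \<phi>"
| "fo_sat D \<nu> (And \<phi> \<psi>) \<longleftrightarrow> fo_sat D \<nu> \<phi> \<and> fo_sat D \<nu> \<psi>"
| "fo_sat D \<nu> (Or \<phi> \<psi>) \<longleftrightarrow> fo_sat D \<nu> \<phi> \<or> fo_sat D \<nu> \<psi>"
| "fo_sat D \<nu> (Ex x \<phi>) \<longleftrightarrow> (\<exists>c. fo_sat D (\<nu>(x := c)) \<phi>)"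

primrec executable :: "'v set \<Rightarrow> ('r, 'v, 'd) fo \<Rightarrow> bool" where
  "executable V (Rel R xs ys) \<longleftrightarrow> set xs \<subseteq> V"
| "executable V (EqVar x y) \<longleftrightarrow> x \<in> V \<or> y \<in> V"
| "executable V (EqConst x c) \<longleftrightarrow> True"
| "executable V (Neg \<phi>) \<longleftrightarrow> executable V \<phi> \<and> FV \<phi> \<subseteq> V"
| "executable V (And \<phi> \<psi>) \<longleftrightarrow> executable V \<phi> \<and> executable (V \<union> FV \<phi>) \<psi>"
| "executable V (Or \<phi> \<psi>) \<longleftrightarrow>
     executable V \<phi> \<and> executable V \<psi> \<and> sym_diff (FV \<phi>) (FV \<psi>) \<subseteq> V"
| "executable V (Ex x \<phi>) \<longleftrightarrow> executable (V - {x}) \<phi>"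

primrec fo_length :: "('r, 'v, 'd) fo \<Rightarrow> nat" where
  "fo_length (Rel R xs ys) = 1 + length xs + length ys"
| "fo_length (EqVar x y) = 3"
| "fo_length (EqConst x c) = 3"
| "fo_length (Neg \<phi>) = 1 + fo_length \<phi>"
| "fo_length (And \<phi> \<psi>) = 1 + fo_length \<phi> + fo_length \<psi>"
| "fo_length (Or \<phi> \<psi>) = 1 + fo_length \<phi> + fo_length \<psi>"
| "fo_length (Ex x \<phi>) = 2 + fo_length \<phi>"

(* Satisfaction of \<phi> only depends on the values at FV \<phi>, which is contained in dom \<nu> here,
   so the unspecified values of the total function (the \<circ> \<nu>) are irrelevant. *)
definition fo_eval ::
  "('r, 'v, 'd) fo \<Rightarrow> 'v set \<Rightarrow> ('r, 'd) inst \<Rightarrow> ('v \<rightharpoonup> 'd) \<Rightarrow> ('v \<rightharpoonup> 'd) set" where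
  "fo_eval \<phi> V D \<nu>in =
     {\<nu>. dom \<nu> = V \<union> FV \<phi> \<and> \<nu>in \<subseteq>\<^sub>m \<nu> \<and> fo_sat D (the \<circ> \<nu>) \<phi>}"

end

theory Submission imports Defs
begin

text \<open>
  For an io-disjoint expression, a pair (\<nu>1, \<nu>2) belongs to the semantics iff \<nu>1 and \<nu>2 agree
  outside the output variables and \<nu>2 satisfies a formula. In a composition \<alpha>;\<beta> the variables in
  O(\<alpha>) \<inter> O(\<beta>) are overwritten by \<beta> without being read, so they are quantified away in the
  formula of \<alpha>. Twice the number of these variables is paid for by the potential 2|O(\<alpha>)|, since
  |O(\<alpha>) \<inter> O(\<beta>)| = |O(\<alpha>)| + |O(\<beta>)| - |O(\<alpha>;\<beta>)|; this keeps the translation linear.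
\<close>

text \<open>\<open>flif_out\<close> is a set while \<open>Ex\<close> binds one variable, so an
  enumeration is chosen. Its order is immaterial; \<open>distinct\<close> makes a finite block cost
  exactly \<open>2 * card A\<close>.\<close>

definition exs :: "'v set \<Rightarrow> ('r, 'v, 'd) fo \<Rightarrow> ('r, 'v, 'd) fo" where
  "exs A \<phi> = foldr Ex (SOME xs. set xs = A \<and> distinct xs) \<phi>"

text \<open>A test and an assignment may share a formula: it speaks of the output valuation only,
  and the condition that nothing outside \<open>flif_out\<close> changes is kept apart from
  it.\<close>

primrec fo_of_flif :: "('r, 'v, 'd) flif \<Rightarrow> ('r, 'v, 'd) fo" where
  "fo_of_flif (FRel R xs ys) = Rel R xs ys"
| "fo_of_flif (FTestVar x y) = EqVar x y"
| "fo_of_flif (FTestConst x c) = EqConst x c"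
| "fo_of_flif (FAssignVar x y) = EqVar x y"
| "fo_of_flif (FAssignConst x c) = EqConst x c"
| "fo_of_flif (FComp \<alpha> \<beta>) =
     And (exs (flif_out \<alpha> \<inter> flif_out \<beta>) (fo_of_flif \<alpha>)) (fo_of_flif \<beta>)"
| "fo_of_flif (FUnion \<alpha> \<beta>) = Or (fo_of_flif \<alpha>) (fo_of_flif \<beta>)"
| "fo_of_flif (FDiff \<alpha> \<beta>) = And (fo_of_flif \<alpha>) (Neg (fo_of_flif \<beta>))"

lemma exs_eq_foldr:
  assumes "finite A"
  shows "\<exists>xs. set xs = A \<and> distinct xs \<and> exs A \<phi> = foldr Ex xs \<phi>"
  using someI_ex[OF finite_distinct_list[OF assms]] unfolding exs_def by blast

lemma fo_over_exs: "finite A \<Longrightarrow> fo_over S (exs A \<phi>) \<longleftrightarrow> fo_over S \<phi>"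
proof -
  have "fo_over S (foldr Ex xs \<phi>) \<longleftrightarrow> fo_over S \<phi>" for xs
    by (induction xs) auto
  then show "finite A \<Longrightarrow> ?thesis" using exs_eq_foldr[of A \<phi>] by auto
qed

lemma FV_exs: "finite A \<Longrightarrow> FV (exs A \<phi>) = FV \<phi> - A"
proof -
  have "FV (foldr Ex xs \<phi>) = FV \<phi> - set xs" for xs
    by (induction xs) auto
  then show "finite A \<Longrightarrow> ?thesis" using exs_eq_foldr[of A \<phi>] by auto
qed

lemma fo_length_exs: "finite A \<Longrightarrow> fo_length (exs A \<phi>) = 2 * card A + fo_length \<phi>"
proof -
  have "fo_length (foldr Ex xs \<phi>) = 2 * length xs + fo_length \<phi>" for xs
    by (induction xs) auto
  then show "finite A \<Longrightarrow> ?thesis" using exs_eq_foldr[of A \<phi>] by (auto simp: distinct_card)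
qed

lemma executable_exs: "finite A \<Longrightarrow> executable V (exs A \<phi>) \<longleftrightarrow> executable (V - A) \<phi>"
proof -
  have "executable V (foldr Ex xs \<phi>) \<longleftrightarrow> executable (V - set xs) \<phi>" for xs
    by (induction xs arbitrary: V) (simp_all flip: Diff_insert2)
  then show "finite A \<Longrightarrow> ?thesis" using exs_eq_foldr[of A \<phi>] by metis
qed

lemma fo_sat_foldr_Ex:
  "fo_sat D \<nu> (foldr Ex xs \<phi>) \<longleftrightarrow> (\<exists>\<mu>. (\<forall>z. z \<notin> set xs \<longrightarrow> \<mu> z = \<nu> z) \<and> fo_sat D \<mu> \<phi>)"
proof (induction xs arbitrary: \<nu>)
  case Nil
  show ?case by (auto simp: fun_eq_iff[symmetric])
next
  case (Cons x xs)
  \<comment> \<open>The outermost quantifier takes the value \<open>\<mu> x\<close>, which merges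
    the nested updates into one valuation.\<close>
  have *: "(\<forall>z. z \<notin> set (x # xs) \<longrightarrow> \<mu> z = \<nu> z)
      \<longleftrightarrow> (\<exists>c. \<forall>z. z \<notin> set xs \<longrightarrow> \<mu> z = (\<nu>(x := c)) z)" for \<mu>
    by (auto intro!: exI[of _ "\<mu> x"])
  show ?case unfolding * by (simp only: foldr.simps o_apply fo_sat.simps Cons.IH) blast
qed

lemma fo_sat_exs:
  "finite A \<Longrightarrow>
    fo_sat D \<nu> (exs A \<phi>) \<longleftrightarrow> (\<exists>\<mu>. (\<forall>z. z \<notin> A \<longrightarrow> \<mu> z = \<nu> z) \<and> fo_sat D \<mu> \<phi>)"
  using exs_eq_foldr[of A \<phi>] by (metis fo_sat_foldr_Ex)

text \<open>\<open>V\<close> occurs only positively in each clause of \<open>executable\<close>, and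
  both \<open>V \<union> FV \<phi>\<close> and \<open>V - {x}\<close> are monotone in
  \<open>V\<close>.\<close>

lemma executable_mono: "executable V \<phi> \<Longrightarrow> V \<subseteq> W \<Longrightarrow> executable W \<phi>"
proof (induction \<phi> arbitrary: V W)
  case (And \<phi> \<psi>)
  moreover from this have "V \<union> FV \<phi> \<subseteq> W \<union> FV \<phi>" by blast
  ultimately show ?case by (metis executable.simps(5))
next
  case (Or \<phi> \<psi>)
  then show ?case using Or.IH[of V W] by auto
next
  case (Ex x \<phi>)
  then show ?case using Ex.IH[of "V - {x}" "W - {x}"] Diff_mono[of V W "{x}" "{x}"] by auto
qed auto

lemma fo_sat_cong: "(\<And>z. z \<in> FV \<phi> \<Longrightarrow> \<nu> z = \<mu> z) \<Longrightarrow> fo_sat D \<nu> \<phi> \<longleftrightarrow> fo_sat D \<mu> \<phi>"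
proof (induction \<phi> arbitrary: \<nu> \<mu>)
  case (Rel R xs ys)
  then have "map \<nu> xs = map \<mu> xs" "map \<nu> ys = map \<mu> ys" by auto
  then show ?case by (simp del: map_eq_conv)
next
  case (And \<phi> \<psi>)
  have "fo_sat D \<nu> \<phi> \<longleftrightarrow> fo_sat D \<mu> \<phi>" "fo_sat D \<nu> \<psi> \<longleftrightarrow> fo_sat D \<mu> \<psi>"
    using And.prems by (auto intro!: And.IH)
  then show ?case by simp
next
  case (Or \<phi> \<psi>)
  have "fo_sat D \<nu> \<phi> \<longleftrightarrow> fo_sat D \<mu> \<phi>" "fo_sat D \<nu> \<psi> \<longleftrightarrow> fo_sat D \<mu> \<psi>"
    using Or.prems by (auto intro!: Or.IH)
  then show ?case by simp
next
  case (Ex x \<phi>)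
  have "fo_sat D (\<nu>(x := c)) \<phi> \<longleftrightarrow> fo_sat D (\<mu>(x := c)) \<phi>" for c
    using Ex.prems by (intro Ex.IH) auto
  then show ?case by simp
next
  case (Neg \<phi>)
  then show ?case by (metis FV.simps(4) fo_sat.simps(4))
qed auto

lemma finite_flif_out [simp]: "finite (flif_out \<alpha>)"
  by (induction \<alpha>) auto

text \<open>In \<open>FDiff\<close>, the outputs of \<beta> that \<alpha> lacks count as inputs
  through the symmetric difference.\<close>

lemma flif_vars_eq: "flif_vars \<alpha> = flif_in \<alpha> \<union> flif_out \<alpha>"
  by (induction \<alpha>) auto

text \<open>In \<open>FComp\<close>, each variable quantified away on the left is an output of
  \<beta> and so remains free on the right.\<close>

lemma FV_fo_of_flif: "FV (fo_of_flif \<alpha>) = flif_vars \<alpha>"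
  by (induction \<alpha>) (auto simp: FV_exs flif_vars_eq)

lemma fo_over_fo_of_flif: "flif_over S \<alpha> \<Longrightarrow> fo_over S (fo_of_flif \<alpha>)"
  by (induction \<alpha>) (auto simp: fo_over_exs)

text \<open>The factor 3 covers an output position of \<open>FRel\<close>, which costs one symbol
  and at most two units of potential, and the two connectives that translate
  \<open>FDiff\<close>.\<close>

lemma fo_length_fo_of_flif:
  "fo_length (fo_of_flif \<alpha>) + 2 * card (flif_out \<alpha>) \<le> 3 * flif_length \<alpha>"
proof (induction \<alpha>)
  case (FRel R xs ys)
  then show ?case using card_length[of ys] by simp
next
  case (FComp \<alpha> \<beta>)
  then show ?case
    using card_Un_Int[of "flif_out \<alpha>" "flif_out \<beta>"] by (simp add: fo_length_exs)
next
  case (FUnion \<alpha> \<beta>)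
  then show ?case using card_Un_le[of "flif_out \<alpha>" "flif_out \<beta>"] by simp
qed auto

lemma io_disjoint_simps [simp]:
  "io_disjoint (FRel R xs ys) \<longleftrightarrow> set xs \<inter> set ys = {}"
  "io_disjoint (FTestVar x y)"
  "io_disjoint (FTestConst x c)"
  "io_disjoint (FAssignVar x y) \<longleftrightarrow> x \<noteq> y"
  "io_disjoint (FAssignConst x c)"
  "io_disjoint (FComp \<alpha> \<beta>) \<longleftrightarrow>
     flif_in (FComp \<alpha> \<beta>) \<inter> flif_out (FComp \<alpha> \<beta>) = {} \<and> io_disjoint \<alpha> \<and> io_disjoint \<beta>"
  "io_disjoint (FUnion \<alpha> \<beta>) \<longleftrightarrow>
     flif_in (FUnion \<alpha> \<beta>) \<inter> flif_out (FUnion \<alpha> \<beta>) = {} \<and> io_disjoint \<alpha> \<and> io_disjoint \<beta>"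
  "io_disjoint (FDiff \<alpha> \<beta>) \<longleftrightarrow>
     flif_in (FDiff \<alpha> \<beta>) \<inter> flif_out (FDiff \<alpha> \<beta>) = {} \<and> io_disjoint \<alpha> \<and> io_disjoint \<beta>"
  by (auto simp: io_disjoint_def)

lemma io_disjointD: "io_disjoint \<alpha> \<Longrightarrow> flif_in \<alpha> \<inter> flif_out \<alpha> = {}"
  by (cases \<alpha>) auto

lemma executable_fo_of_flif: "io_disjoint \<alpha> \<Longrightarrow> executable (flif_in \<alpha>) (fo_of_flif \<alpha>)"
proof (induction \<alpha>)
  case (FComp \<alpha> \<beta>)
  \<comment> \<open>Inputs of \<alpha> are inputs of the composition, hence not among its outputs;
    removing the quantified variables loses none of them.\<close>
  have "executable (flif_in (FComp \<alpha> \<beta>) - flif_out \<alpha> \<inter> flif_out \<beta>) (fo_of_flif \<alpha>)"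
    using FComp by (intro executable_mono[OF FComp.IH(1)]) auto
  \<comment> \<open>An input of \<beta> produced by \<alpha> is therefore not an output of \<beta>,
    so it escapes quantification and is bound by the left conjunct.\<close>
  moreover have "flif_in \<beta> \<inter> flif_out \<beta> = {}"
    using FComp.prems io_disjointD by auto
  then have "executable (flif_in (FComp \<alpha> \<beta>) \<union>
      FV (exs (flif_out \<alpha> \<inter> flif_out \<beta>) (fo_of_flif \<alpha>))) (fo_of_flif \<beta>)"
    using FComp.prems
    by (intro executable_mono[OF FComp.IH(2)])
      (auto simp: FV_exs FV_fo_of_flif flif_vars_eq)
  ultimately show ?case by (simp add: executable_exs)
next
  case (FUnion \<alpha> \<beta>)
  have "executable (flif_in (FUnion \<alpha> \<beta>)) (fo_of_flif \<alpha>)"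
    using FUnion.prems by (intro executable_mono[OF FUnion.IH(1)]) auto
  moreover have "executable (flif_in (FUnion \<alpha> \<beta>)) (fo_of_flif \<beta>)"
    using FUnion.prems by (intro executable_mono[OF FUnion.IH(2)]) auto
  ultimately show ?case by (auto simp: FV_fo_of_flif flif_vars_eq)
next
  case (FDiff \<alpha> \<beta>)
  have "executable (flif_in (FDiff \<alpha> \<beta>)) (fo_of_flif \<alpha>)"
    using FDiff.prems by (intro executable_mono[OF FDiff.IH(1)]) auto
  moreover have "executable (flif_in (FDiff \<alpha> \<beta>) \<union> FV (fo_of_flif \<alpha>)) (fo_of_flif \<beta>)"
    using FDiff.prems by (intro executable_mono[OF FDiff.IH(2)]) auto
  \<comment> \<open>Negation needs all variables of \<beta>: its outputs are bound by the formula of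
    \<alpha> or are inputs through the symmetric difference.\<close>
  ultimately show ?case by (auto simp: FV_fo_of_flif flif_vars_eq)
qed auto

text \<open>Inputs keep their values, so \<nu>2 alone records what was read as well as what was
  written.\<close>

lemma flif_sem_iff_fo_sat:
  "io_disjoint \<alpha> \<Longrightarrow>
    (\<nu>1, \<nu>2) \<in> flif_sem D \<alpha> \<longleftrightarrow>
      (\<forall>z. z \<notin> flif_out \<alpha> \<longrightarrow> \<nu>1 z = \<nu>2 z) \<and> fo_sat D \<nu>2 (fo_of_flif \<alpha>)"
proof (induction \<alpha> arbitrary: \<nu>1 \<nu>2)
  case (FRel R xs ys)
  have "map \<nu>1 xs = map \<nu>2 xs" if "\<forall>z. z \<notin> set ys \<longrightarrow> \<nu>1 z = \<nu>2 z"
    using that FRel by (intro map_cong) auto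
  then show ?case by (auto simp del: map_eq_conv)
next
  case (FAssignVar x y)
  \<comment> \<open>Here \<open>x \<noteq> y\<close>, so \<open>\<nu>2 y\<close> is still the value
    that was copied.\<close>
  then show ?case by (simp add: fun_eq_iff) metis
next
  case (FAssignConst x c)
  then show ?case by (simp add: fun_eq_iff) metis
next
  case (FComp \<alpha> \<beta>)
  let ?A = "flif_out \<alpha>" and ?B = "flif_out \<beta>"
  \<comment> \<open>Hence \<beta> can change a free variable of the formula of \<alpha> only inside
    \<open>?A \<inter> ?B\<close>.\<close>
  have disj: "flif_in \<alpha> \<inter> ?B = {}" using FComp.prems by auto
  have sem: "(\<nu>1, \<nu>2) \<in> flif_sem D (FComp \<alpha> \<beta>) \<longleftrightarrow>
      (\<exists>\<mu>. (\<forall>z. z \<notin> ?A \<longrightarrow> \<nu>1 z = \<mu> z) \<and> fo_sat D \<mu> (fo_of_flif \<alpha>) \<and>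
           (\<forall>z. z \<notin> ?B \<longrightarrow> \<mu> z = \<nu>2 z)) \<and> fo_sat D \<nu>2 (fo_of_flif \<beta>)"
  proof -
    have "io_disjoint \<alpha>" "io_disjoint \<beta>" using FComp.prems by simp_all
    then show ?thesis
      by (simp only: flif_sem.simps relcomp_unfold mem_Collect_eq case_prod_conv FComp.IH) blast
  qed
  have "(\<exists>\<mu>. (\<forall>z. z \<notin> ?A \<longrightarrow> \<nu>1 z = \<mu> z) \<and> fo_sat D \<mu> (fo_of_flif \<alpha>) \<and>
             (\<forall>z. z \<notin> ?B \<longrightarrow> \<mu> z = \<nu>2 z)) \<longleftrightarrow>
        (\<forall>z. z \<notin> ?A \<union> ?B \<longrightarrow> \<nu>1 z = \<nu>2 z) \<and>
        (\<exists>\<mu>. (\<forall>z. z \<notin> ?A \<inter> ?B \<longrightarrow> \<mu> z = \<nu>2 z) \<and> fo_sat D \<mu> (fo_of_flif \<alpha>))"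
    (is "?L \<longleftrightarrow> ?R")
  proof
    assume ?L
    then obtain \<mu> where \<mu>: "\<forall>z. z \<notin> ?A \<longrightarrow> \<nu>1 z = \<mu> z" "fo_sat D \<mu> (fo_of_flif \<alpha>)"
      "\<forall>z. z \<notin> ?B \<longrightarrow> \<mu> z = \<nu>2 z" by blast
    \<comment> \<open>Off \<open>?B\<close>, \<mu> already equals \<nu>2, so \<mu>' differs from
      \<mu> only on variables that the formula of \<alpha> does not mention.\<close>
    define \<mu>' where "\<mu>' z = (if z \<in> ?A \<inter> ?B then \<mu> z else \<nu>2 z)" for z
    have "fo_sat D \<mu>' (fo_of_flif \<alpha>) \<longleftrightarrow> fo_sat D \<mu> (fo_of_flif \<alpha>)"
      using \<mu>(3) disj by (intro fo_sat_cong) (auto simp: \<mu>'_def FV_fo_of_flif flif_vars_eq)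
    then have "fo_sat D \<mu>' (fo_of_flif \<alpha>)" using \<mu>(2) by simp
    moreover have "\<forall>z. z \<notin> ?A \<inter> ?B \<longrightarrow> \<mu>' z = \<nu>2 z" by (simp add: \<mu>'_def)
    moreover have "\<forall>z. z \<notin> ?A \<union> ?B \<longrightarrow> \<nu>1 z = \<nu>2 z" using \<mu>(1,3) by simp
    ultimately show ?R by blast
  next
    assume ?R
    then obtain \<mu> where \<mu>: "\<forall>z. z \<notin> ?A \<union> ?B \<longrightarrow> \<nu>1 z = \<nu>2 z"
      "\<forall>z. z \<notin> ?A \<inter> ?B \<longrightarrow> \<mu> z = \<nu>2 z" "fo_sat D \<mu> (fo_of_flif \<alpha>)" by blast
    \<comment> \<open>This is the intermediate valuation: \<alpha> writes the values of \<mu> and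
      leaves the rest of \<nu>1 intact.\<close>
    define \<mu>' where "\<mu>' z = (if z \<in> ?A then \<mu> z else \<nu>1 z)" for z
    have "fo_sat D \<mu>' (fo_of_flif \<alpha>) \<longleftrightarrow> fo_sat D \<mu> (fo_of_flif \<alpha>)"
      using \<mu>(1,2) disj by (intro fo_sat_cong) (auto simp: \<mu>'_def FV_fo_of_flif flif_vars_eq)
    then have "fo_sat D \<mu>' (fo_of_flif \<alpha>)" using \<mu>(3) by simp
    moreover have "\<forall>z. z \<notin> ?A \<longrightarrow> \<nu>1 z = \<mu>' z" by (simp add: \<mu>'_def)
    moreover have "\<forall>z. z \<notin> ?B \<longrightarrow> \<mu>' z = \<nu>2 z" using \<mu>(1,2) by (simp add: \<mu>'_def)
    ultimately show ?L by blast
  qed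
  then show ?case
    unfolding sem
    by (simp only: fo_of_flif.simps fo_sat.simps flif_out.simps fo_sat_exs finite_flif_out
        finite_Int simp_thms conj_assoc)
next
  case (FUnion \<alpha> \<beta>)
  \<comment> \<open>The symmetric difference of the outputs lies in both the inputs and the outputs
    of the union, hence is empty.\<close>
  then have "flif_out \<alpha> = flif_out \<beta>" by auto
  then show ?case using FUnion by auto
next
  case (FDiff \<alpha> \<beta>)
  \<comment> \<open>With this inclusion, agreement outside the outputs of \<alpha> implies agreement
    outside those of \<beta>, so the difference reduces to negating a formula.\<close>
  then have "flif_out \<alpha> \<subseteq> flif_out \<beta>" by auto
  then show ?case using FDiff by auto
qed (auto simp: fun_eq_iff[symmetric])

lemma flif_eval_eq_fo_eval:
  assumes "io_disjoint \<alpha>" "dom \<nu>in = flif_in \<alpha>"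
  shows "flif_eval \<alpha> D \<nu>in = fo_eval (fo_of_flif \<alpha>) (flif_in \<alpha>) D \<nu>in"
proof (intro set_eqI iffI)
  fix \<nu>
  assume "\<nu> \<in> flif_eval \<alpha> D \<nu>in"
  then obtain \<nu>out \<nu>in' where \<nu>: "\<nu> = (Some \<circ> \<nu>out) |` flif_vars \<alpha>" "\<nu>in \<subseteq>\<^sub>m Some \<circ> \<nu>in'"
    "\<forall>z. z \<notin> flif_out \<alpha> \<longrightarrow> \<nu>in' z = \<nu>out z" "fo_sat D \<nu>out (fo_of_flif \<alpha>)"
    using flif_sem_iff_fo_sat[OF assms(1)] by (auto simp: flif_eval_def)
  have "fo_sat D (the \<circ> \<nu>) (fo_of_flif \<alpha>) \<longleftrightarrow> fo_sat D \<nu>out (fo_of_flif \<alpha>)"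
    by (rule fo_sat_cong) (simp add: \<nu>(1) FV_fo_of_flif)
  \<comment> \<open>Input variables are never outputs, so their values survive in
    \<open>\<nu>out\<close>.\<close>
  moreover have "\<nu>in \<subseteq>\<^sub>m \<nu>"
    using \<nu>(1-3) assms(2) io_disjointD[OF assms(1)]
    by (auto simp: map_le_def restrict_map_def flif_vars_eq)
  moreover have "dom \<nu> = flif_vars \<alpha>" using \<nu>(1) by (auto simp: dom_def restrict_map_def)
  ultimately show "\<nu> \<in> fo_eval (fo_of_flif \<alpha>) (flif_in \<alpha>) D \<nu>in"
    using \<nu>(4) by (auto simp: fo_eval_def FV_fo_of_flif flif_vars_eq)
next
  fix \<nu>
  assume "\<nu> \<in> fo_eval (fo_of_flif \<alpha>) (flif_in \<alpha>) D \<nu>in"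
  then have \<nu>: "dom \<nu> = flif_vars \<alpha>" "\<nu>in \<subseteq>\<^sub>m \<nu>" "fo_sat D (the \<circ> \<nu>) (fo_of_flif \<alpha>)"
    by (auto simp: fo_eval_def FV_fo_of_flif flif_vars_eq)
  have "\<nu> = (Some \<circ> (the \<circ> \<nu>)) |` flif_vars \<alpha>"
  proof
    fix x
    show "\<nu> x = ((Some \<circ> (the \<circ> \<nu>)) |` flif_vars \<alpha>) x"
      unfolding \<nu>(1)[symmetric] by (cases "\<nu> x") (auto simp: restrict_map_def dom_def)
  qed
  moreover have "\<nu>in \<subseteq>\<^sub>m Some \<circ> (the \<circ> \<nu>)"
    using \<nu>(2) by (force simp: map_le_def dom_def)
  \<comment> \<open>A satisfying valuation serves as its own input: on a diagonal pair the agreement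
    condition is trivial.\<close>
  moreover have "(the \<circ> \<nu>, the \<circ> \<nu>) \<in> flif_sem D \<alpha>"
    using \<nu>(3) by (simp add: flif_sem_iff_fo_sat[OF assms(1)])
  ultimately show "\<nu> \<in> flif_eval \<alpha> D \<nu>in" by (auto simp: flif_eval_def)
qed

theorem theorem5p4:
  "\<exists>C::nat. \<forall>(S :: 'r schema) (\<alpha> :: ('r, 'v, 'd::{countable, infinite}) flif).
     is_schema S \<longrightarrow> flif_over S \<alpha> \<longrightarrow> io_disjoint \<alpha> \<longrightarrow>
     (\<exists>\<phi> :: ('r, 'v, 'd) fo.
        fo_over S \<phi> \<and>
        executable (flif_in \<alpha>) \<phi> \<and>
        FV \<phi> = flif_vars \<alpha> \<and>
        fo_length \<phi> \<le> C * flif_length \<alpha> \<and>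
        (\<forall>(D :: ('r, 'd) inst) (\<nu>in :: 'v \<rightharpoonup> 'd).
           is_instance S D \<longrightarrow> dom \<nu>in = flif_in \<alpha> \<longrightarrow>
           flif_eval \<alpha> D \<nu>in = fo_eval \<phi> (flif_in \<alpha>) D \<nu>in))"
proof (intro exI[of _ 3] allI impI)
  fix S :: "'r schema" and \<alpha> :: "('r, 'v, 'd) flif"
  assume over: "flif_over S \<alpha>" and disj: "io_disjoint \<alpha>"
  \<comment> \<open>Dropping the nonnegative potential leaves a constant independent of the schema
    and the expression.\<close>
  have "fo_length (fo_of_flif \<alpha>) \<le> 3 * flif_length \<alpha>"
    using fo_length_fo_of_flif[of \<alpha>] by linarith
  then show "\<exists>\<phi> :: ('r, 'v, 'd) fo.
        fo_over S \<phi> \<and>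
        executable (flif_in \<alpha>) \<phi> \<and>
        FV \<phi> = flif_vars \<alpha> \<and>
        fo_length \<phi> \<le> 3 * flif_length \<alpha> \<and>
        (\<forall>(D :: ('r, 'd) inst) (\<nu>in :: 'v \<rightharpoonup> 'd).
           is_instance S D \<longrightarrow> dom \<nu>in = flif_in \<alpha> \<longrightarrow>
           flif_eval \<alpha> D \<nu>in = fo_eval \<phi> (flif_in \<alpha>) D \<nu>in)"
    using fo_over_fo_of_flif[OF over] executable_fo_of_flif[OF disj] FV_fo_of_flif[of \<alpha>]
      flif_eval_eq_fo_eval[OF disj]
    by (intro exI[of _ "fo_of_flif \<alpha>"]) simp
qed

end
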